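(* Let $(\gamma_+,\gamma_-)$ be an angularly regular parallel pair of cooriented frontal germs in $\mathbb{R}^2$ with common angular parameter $u$ near $0$: $\gamma_+'=\rho_+\mathbf e$, $\gamma_-'=-\rho_-\mathbf e$. Put $\Sigma_\rho=\rho_++\rho_-$ and $\Delta_\gamma=\gamma_+-\gamma_-$. The map $$\widetilde S(u)=[\rho_-(u)\gamma_+(u)+\rho_+(u)\gamma_-(u):\Sigma_\rho(u)]\in\mathbb{RP}^2$$ agrees with the affine centre symmetry set whenever $\Sigma_\rho\ne0$. Suppose $\Delta_\gamma(0)\ne0$. (i) If $\Sigma_\rho(0)=0$ and $\rho_+(0)\rho_-(0)\ne0$, then $\widetilde S(0)=[\Delta_\gamma(0):0]$, up to a nonzero homogeneous factor; thus the centre symmetry set point is at infinity in the direction of the chord. (ii) Suppose $\rho_+$ and $\rho_-$ have zeros at $0$ of finite positive orders $p$ and $q$, respectively. After cancelling the common factor $u^{\min\{p,q\}}$ in the homogeneous coordinates, $\widetilde S$ extends to $u=0$. If $p<q$, the limit is $[\gamma_-(0):1]$. If $q<p$, it is $[\gamma_+(0):1]$. (iii) If $p=q$ and $\rho_+(u)=a_+u^p+O(u^{p+1})$, $\rho_-(u)=a_-u^p+O(u^{p+1})$ with $a_+a_-\ne0$, then the limit is $$\left[\frac{a_-\gamma_+(0)+a_+\gamma_-(0)}{a_++a_-}:1\right]$$ when $a_++a_-\neq0$, and is $[\Delta_\gamma(0):0]$ when $a_++a_-=0$.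
   Context: A smooth germ $\gamma:(\mathbb R,0)\to\mathbb R^2$ is a cooriented frontal if it has a smooth unit normal field $\mathbf n$ with $\gamma'\cdot\mathbf n=0$; choosing the unit tangent field $\mathbf e=(\cos\theta,\sin\theta)$ so that $(\mathbf e,\mathbf n)$ is positively oriented, $\gamma'=\ell\mathbf e$ with smooth $\ell,\theta$. It is angularly regular if $\theta'\neq0$. Angularly regular parallel pair: two angularly regular cooriented frontal germs $\gamma_\pm$ whose tangent lines at the base points are parallel, tangent lifts chosen opposite at the base points. Both are parametrised by a common angular parameter $u$ near $0$, with $\gamma_+'(u)=\rho_+(u)\mathbf e(u)$, $\gamma_-'(u)=-\rho_-(u)\mathbf e(u)$, where $\mathbf e(u)=(\cos(u+\theta_0),\sin(u+\theta_0))$ for a constant $\theta_0$, and $\rho_\pm$ are smooth (extended signed radii of curvature, possibly vanishing). The affine centre symmetry set is the envelope of the chord lines $\gamma_-(u)+\lambda\Delta_\gamma(u)$ (for chords transverse to the common tangent, $\det(\Delta_\gamma,\mathbf e)\ne0$); where $\Sigma_\rho\neq0$ it is parametrised by $S(u)=\gamma_-(u)+\frac{\rho_-(u)}{\Sigma_\rho(u)}\Delta_\gamma(u)$. Points of $\mathbb{RP}^2$ are written $[x:w]$ with $x\in\mathbb R^2$, $w\in\mathbb R$, and $\mathbb R^2$ is embedded by $x\mapsto[x:1]$. *)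

theory Defs
  imports "HOL-Analysis.Analysis" "HOL-Library.Landau_Symbols"
begin

section \<open>Smooth germs at 0\<close>

definition nth_vderiv :: "nat \<Rightarrow> (real \<Rightarrow> 'a::real_normed_vector) \<Rightarrow> real \<Rightarrow> 'a" where
  "nth_vderiv n f = ((\<lambda>g t. vector_derivative g (at t)) ^^ n) f"

text \<open>A germ is represented by a total function; only its values near 0 matter.  The
  neighbourhood does not depend on the order \<open>n\<close> of differentiation.\<close>

definition smooth_germ :: "(real \<Rightarrow> 'a::real_normed_vector) \<Rightarrow> bool" where
  "smooth_germ f \<longleftrightarrow>
     (\<exists>\<epsilon>>0. \<forall>n t. \<bar>t\<bar> < \<epsilon> \<longrightarrow> nth_vderiv n f differentiable (at t))"

definition zero_order :: "(real \<Rightarrow> real) \<Rightarrow> nat \<Rightarrow> bool" where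
  "zero_order f p \<longleftrightarrow> (\<forall>k<p. nth_vderiv k f 0 = 0) \<and> nth_vderiv p f 0 \<noteq> 0"

section \<open>Frontals and parallel pairs\<close>

definition unit_vec :: "real \<Rightarrow> real^2" where
  "unit_vec t = vector [cos t, sin t]"

definition rot90 :: "real^2 \<Rightarrow> real^2" where
  "rot90 v = vector [- v$2, v$1]"

definition det2 :: "real^2 \<Rightarrow> real^2 \<Rightarrow> real" where
  "det2 v w = det (vector [v, w] :: real^2^2)"

definition cooriented_frontal :: "(real \<Rightarrow> real^2) \<Rightarrow> (real \<Rightarrow> real^2) \<Rightarrow> bool" where
  "cooriented_frontal \<gamma> n \<longleftrightarrow> smooth_germ \<gamma> \<and> smooth_germ n \<and>
     (\<forall>\<^sub>F u in nhds 0. norm (n u) = 1 \<and> vector_derivative \<gamma> (at u) \<bullet> n u = 0)"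

text \<open>The unit tangent field is \<open>unit_vec (\<theta> u)\<close>; the condition on \<open>n\<close> says that the frame
  (tangent, normal) is positively oriented.\<close>

definition tangent_lift ::
    "(real \<Rightarrow> real^2) \<Rightarrow> (real \<Rightarrow> real^2) \<Rightarrow> (real \<Rightarrow> real) \<Rightarrow> (real \<Rightarrow> real) \<Rightarrow> bool" where
  "tangent_lift \<gamma> n \<theta> l \<longleftrightarrow> smooth_germ \<theta> \<and> smooth_germ l \<and>
     (\<forall>\<^sub>F u in nhds 0. n u = rot90 (unit_vec (\<theta> u)) \<and>
        (\<gamma> has_vector_derivative l u *\<^sub>R unit_vec (\<theta> u)) (at u))"

text \<open>For germs, \<open>\<theta>' \<noteq> 0\<close> at 0 is the same as \<open>\<theta>' \<noteq> 0\<close> near 0.  The last condition says that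
  the tangent lines at the base points are parallel, with opposite tangent lifts.\<close>

definition angularly_regular_parallel_pair ::
    "(real \<Rightarrow> real^2) \<Rightarrow> (real \<Rightarrow> real^2) \<Rightarrow> (real \<Rightarrow> real^2) \<Rightarrow> (real \<Rightarrow> real^2) \<Rightarrow> bool" where
  "angularly_regular_parallel_pair \<gamma>p np \<gamma>m nm \<longleftrightarrow>
     cooriented_frontal \<gamma>p np \<and> cooriented_frontal \<gamma>m nm \<and>
     (\<exists>\<theta>p lp \<theta>m lm. tangent_lift \<gamma>p np \<theta>p lp \<and> tangent_lift \<gamma>m nm \<theta>m lm \<and>
        deriv \<theta>p 0 \<noteq> 0 \<and> deriv \<theta>m 0 \<noteq> 0 \<and>
        unit_vec (\<theta>m 0) = - unit_vec (\<theta>p 0))"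

text \<open>The parameter \<open>u\<close> is a common angular parameter: the tangent lifts are \<open>e u\<close> and \<open>- e u\<close>
  with \<open>e u = unit_vec (u + \<theta>0)\<close>.\<close>

definition common_angular_parameter ::
    "real \<Rightarrow> (real \<Rightarrow> real^2) \<Rightarrow> (real \<Rightarrow> real^2) \<Rightarrow> (real \<Rightarrow> real^2) \<Rightarrow> (real \<Rightarrow> real^2)
      \<Rightarrow> (real \<Rightarrow> real) \<Rightarrow> (real \<Rightarrow> real) \<Rightarrow> bool" where
  "common_angular_parameter \<theta>0 \<gamma>p np \<gamma>m nm \<rho>p \<rho>m \<longleftrightarrow> smooth_germ \<rho>p \<and> smooth_germ \<rho>m \<and>
     (\<forall>\<^sub>F u in nhds 0.
        np u = rot90 (unit_vec (u + \<theta>0)) \<and> nm u = rot90 (- unit_vec (u + \<theta>0)) \<and>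
        (\<gamma>p has_vector_derivative \<rho>p u *\<^sub>R unit_vec (u + \<theta>0)) (at u) \<and>
        (\<gamma>m has_vector_derivative - (\<rho>m u *\<^sub>R unit_vec (u + \<theta>0))) (at u))"

section \<open>The affine centre symmetry set\<close>

text \<open>The points contributed by the parameter \<open>u\<close> to the envelope (discriminant) of the family of
  curves \<open>{x. F s x = 0}\<close>.\<close>

definition envelope_at :: "(real \<Rightarrow> real^2 \<Rightarrow> real) \<Rightarrow> real \<Rightarrow> (real^2) set" where
  "envelope_at F u = {x. F u x = 0 \<and> ((\<lambda>s. F s x) has_real_derivative 0) (at u)}"

text \<open>If \<open>\<gamma>p s \<noteq> \<gamma>m s\<close>, the zero set of \<open>\<lambda>x. det2 (x - \<gamma>m s) (\<gamma>p s - \<gamma>m s)\<close> is the chord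
  line \<open>{\<gamma>m s + \<lambda> *\<^sub>R (\<gamma>p s - \<gamma>m s) | \<lambda>. True}\<close>.\<close>

definition affine_css_at :: "(real \<Rightarrow> real^2) \<Rightarrow> (real \<Rightarrow> real^2) \<Rightarrow> real \<Rightarrow> (real^2) set" where
  "affine_css_at \<gamma>p \<gamma>m u = envelope_at (\<lambda>s x. det2 (x - \<gamma>m s) (\<gamma>p s - \<gamma>m s)) u"

definition affine_css_param ::
    "(real \<Rightarrow> real^2) \<Rightarrow> (real \<Rightarrow> real^2) \<Rightarrow> (real \<Rightarrow> real) \<Rightarrow> (real \<Rightarrow> real) \<Rightarrow> real \<Rightarrow> real^2" where
  "affine_css_param \<gamma>p \<gamma>m \<rho>p \<rho>m u =
     \<gamma>m u + (\<rho>m u / (\<rho>p u + \<rho>m u)) *\<^sub>R (\<gamma>p u - \<gamma>m u)"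

section \<open>The real projective plane\<close>

definition proj_rel :: "(real^2) \<times> real \<Rightarrow> (real^2) \<times> real \<Rightarrow> bool" where
  "proj_rel v w \<longleftrightarrow> v \<noteq> 0 \<and> w \<noteq> 0 \<and> (\<exists>c. c \<noteq> 0 \<and> w = c *\<^sub>R v)"

lemma part_equivp_proj_rel: "part_equivp proj_rel"
proof (rule part_equivpI)
  show "\<exists>v. proj_rel v v"
    by (rule exI[of _ "(0, 1)"]) (auto simp: proj_rel_def zero_prod_def intro!: exI[of _ 1])
  show "symp proj_rel"
  proof (rule sympI)
    fix v w assume "proj_rel v w"
    then obtain c where "v \<noteq> 0" "w \<noteq> 0" "c \<noteq> 0" "w = c *\<^sub>R v"
      by (auto simp: proj_rel_def)
    then show "proj_rel w v"
      by (auto simp: proj_rel_def intro!: exI[of _ "inverse c"])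
  qed
  show "transp proj_rel"
  proof (rule transpI)
    fix u v w assume "proj_rel u v" "proj_rel v w"
    then obtain c d where "u \<noteq> 0" "w \<noteq> 0" "c \<noteq> 0" "d \<noteq> 0" "v = c *\<^sub>R u" "w = d *\<^sub>R v"
      by (auto simp: proj_rel_def)
    then show "proj_rel u w"
      unfolding proj_rel_def by (intro conjI exI[of _ "d * c"]) auto
  qed
qed

quotient_type rp2 = "(real^2) \<times> real" / partial: proj_rel
  by (rule part_equivp_proj_rel)

text \<open>The point \<open>[x : w]\<close>; for \<open>x = 0\<close>, \<open>w = 0\<close> the value is unspecified.\<close>

definition hpt :: "real^2 \<Rightarrow> real \<Rightarrow> rp2" where
  "hpt x w = abs_rp2 (x, w)"

lemma hpt_eq_iff:
  assumes "(x, w) \<noteq> 0" "(y, z) \<noteq> 0"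
  shows "hpt x w = hpt y z \<longleftrightarrow> (\<exists>c. c \<noteq> 0 \<and> y = c *\<^sub>R x \<and> z = c * w)"
proof -
  have refl: "proj_rel v v" if "v \<noteq> 0" for v
    using that by (auto simp: proj_rel_def intro!: exI[of _ 1])
  show ?thesis
    using Quotient3_rel[OF Quotient3_rp2, of "(x, w)" "(y, z)"] refl[OF assms(1)] refl[OF assms(2)] assms
    by (auto simp: hpt_def proj_rel_def)
qed

text \<open>Quotient topology of the nonzero vectors.\<close>

instantiation rp2 :: topological_space
begin

definition open_rp2 :: "rp2 set \<Rightarrow> bool" where
  "open_rp2 U \<longleftrightarrow> open {v. v \<noteq> 0 \<and> abs_rp2 v \<in> U}"

instance
proof
  show "open (UNIV :: rp2 set)"
    unfolding open_rp2_def by (simp add: Collect_neg_eq open_Compl)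
next
  fix S T :: "rp2 set" assume "open S" "open T"
  then have "open ({v. v \<noteq> 0 \<and> abs_rp2 v \<in> S} \<inter> {v. v \<noteq> 0 \<and> abs_rp2 v \<in> T})"
    unfolding open_rp2_def by (rule open_Int)
  moreover have "{v. v \<noteq> 0 \<and> abs_rp2 v \<in> S} \<inter> {v. v \<noteq> 0 \<and> abs_rp2 v \<in> T}
      = {v. v \<noteq> 0 \<and> abs_rp2 v \<in> S \<inter> T}" by auto
  ultimately show "open (S \<inter> T)" unfolding open_rp2_def by simp
next
  fix K :: "rp2 set set" assume "\<forall>S\<in>K. open S"
  then have "open (\<Union>S\<in>K. {v. v \<noteq> 0 \<and> abs_rp2 v \<in> S})"
    unfolding open_rp2_def by (intro open_UN) auto
  moreover have "(\<Union>S\<in>K. {v. v \<noteq> 0 \<and> abs_rp2 v \<in> S}) = {v. v \<noteq> 0 \<and> abs_rp2 v \<in> \<Union>K}" by auto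
  ultimately show "open (\<Union>K)" unfolding open_rp2_def by simp
qed

end

section \<open>The projective centre symmetry map\<close>

definition css_numerator ::
    "(real \<Rightarrow> real^2) \<Rightarrow> (real \<Rightarrow> real^2) \<Rightarrow> (real \<Rightarrow> real) \<Rightarrow> (real \<Rightarrow> real) \<Rightarrow> real \<Rightarrow> real^2" where
  "css_numerator \<gamma>p \<gamma>m \<rho>p \<rho>m u = \<rho>m u *\<^sub>R \<gamma>p u + \<rho>p u *\<^sub>R \<gamma>m u"

definition projective_css ::
    "(real \<Rightarrow> real^2) \<Rightarrow> (real \<Rightarrow> real^2) \<Rightarrow> (real \<Rightarrow> real) \<Rightarrow> (real \<Rightarrow> real) \<Rightarrow> real \<Rightarrow> rp2" where
  "projective_css \<gamma>p \<gamma>m \<rho>p \<rho>m u = hpt (css_numerator \<gamma>p \<gamma>m \<rho>p \<rho>m u) (\<rho>p u + \<rho>m u)"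

text \<open>Homogeneous coordinates \<open>(X, W)\<close> are obtained from \<open>(x, w)\<close> by cancelling \<open>u ^ m\<close>, and are
  admissible (not both zero) up to and including \<open>u = 0\<close>; hence \<open>hpt (X u) (W u)\<close> extends
  \<open>hpt (x u) (w u)\<close> to \<open>u = 0\<close>.\<close>

definition cancelled_coords ::
    "nat \<Rightarrow> (real \<Rightarrow> real^2) \<Rightarrow> (real \<Rightarrow> real) \<Rightarrow> (real \<Rightarrow> real^2) \<Rightarrow> (real \<Rightarrow> real) \<Rightarrow> bool" where
  "cancelled_coords m x w X W \<longleftrightarrow> smooth_germ X \<and> smooth_germ W \<and>
     (\<forall>\<^sub>F u in nhds 0. x u = u ^ m *\<^sub>R X u \<and> w u = u ^ m * W u \<and> (X u, W u) \<noteq> 0)"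

end

theory Submission
  imports Defs
begin

text \<open>By Hadamard's lemma a smooth function with a zero of order at least \<open>m\<close> is \<open>u ^ m\<close> times a
  smooth function.  Writing \<open>\<rho>p = u ^ m A\<close> and \<open>\<rho>m = u ^ m B\<close> with \<open>m = min p q\<close>, the
  homogeneous coordinates of the centre symmetry map are \<open>u ^ m\<close> times those belonging to \<open>A\<close> and
  \<open>B\<close>, which do not both vanish at 0 because \<open>A\<close> and \<open>B\<close> do not and the chord is nonzero; all
  limits are then read off at \<open>u = 0\<close>.\<close>

section \<open>Calculus of smooth germs\<close>

lemma nth_vderiv_0 [simp]: "nth_vderiv 0 f = f"
  by (simp add: nth_vderiv_def)

lemma nth_vderiv_Suc: "nth_vderiv (Suc n) f t = vector_derivative (nth_vderiv n f) (at t)"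
  by (simp add: nth_vderiv_def)

lemma smooth_germ_iff:
  "smooth_germ f \<longleftrightarrow> (\<exists>\<epsilon>>0. \<forall>n t. \<bar>t\<bar> < \<epsilon> \<longrightarrow>
     (nth_vderiv n f has_vector_derivative nth_vderiv (Suc n) f t) (at t))"
  unfolding smooth_germ_def nth_vderiv_Suc by (simp add: vector_derivative_works)

lemma has_vector_derivative_cong_ball:
  assumes "\<And>t. \<bar>t\<bar> < \<epsilon> \<Longrightarrow> f t = g t" and "\<bar>x\<bar> < \<epsilon>"
    and "(f has_vector_derivative D) (at x)"
  shows "(g has_vector_derivative D) (at x)"
proof (rule has_vector_derivative_transform_within_open[OF assms(3)])
  show "open {-\<epsilon><..<\<epsilon>}" "x \<in> {-\<epsilon><..<\<epsilon>}" using assms(2) by auto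
  show "\<And>t. t \<in> {-\<epsilon><..<\<epsilon>} \<Longrightarrow> f t = g t" using assms(1) by auto
qed

context
  fixes F :: "nat \<Rightarrow> real \<Rightarrow> 'a::real_normed_vector" and f :: "real \<Rightarrow> 'a" and \<epsilon> :: real
  assumes eps: "\<epsilon> > 0" and base: "\<And>t. \<bar>t\<bar> < \<epsilon> \<Longrightarrow> F 0 t = f t"
    and step: "\<And>n t. \<bar>t\<bar> < \<epsilon> \<Longrightarrow> (F n has_vector_derivative F (Suc n) t) (at t)"
begin

text \<open>Differentiating at \<open>t\<close> sees only values near \<open>t\<close>, and the
  interval is open, so agreement with \<open>F n\<close> on all of it passes to
  \<open>F (Suc n)\<close>. This is why \<open>t\<close> is arbitrary in the induction; outside the
  interval nothing is claimed.\<close>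

lemma nth_vderiv_eq_tower: "\<bar>t\<bar> < \<epsilon> \<Longrightarrow> nth_vderiv n f t = F n t"
proof (induction n arbitrary: t)
  case (Suc n)
  have "(nth_vderiv n f has_vector_derivative F (Suc n) t) (at t)"
    by (rule has_vector_derivative_cong_ball[of \<epsilon> "F n"]) (use Suc step in auto)
  then show ?case by (simp add: nth_vderiv_Suc vector_derivative_at)
qed (simp add: base)

text \<open>Reduces smoothness to exhibiting candidates for all derivatives on one interval whose
  radius does not depend on the order.\<close>

lemma smooth_germ_tower: "smooth_germ f"
  unfolding smooth_germ_iff
proof (intro exI conjI allI impI)
  fix n t assume "\<bar>t\<bar> < \<epsilon>"
  show "(nth_vderiv n f has_vector_derivative nth_vderiv (Suc n) f t) (at t)"
    by (rule has_vector_derivative_cong_ball[of \<epsilon> "F n"])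
       (use \<open>\<bar>t\<bar> < \<epsilon>\<close> nth_vderiv_eq_tower step in auto)
qed (rule eps)

end

text \<open>Choosing for each member of \<open>C\<close> a derivative that is again in
  \<open>C\<close> and iterating the choice produces a tower. This serves when higher derivatives
  are awkward to write in closed form.\<close>

lemma smooth_germ_coinduct:
  assumes "\<epsilon> > 0" "f \<in> C"
    and closed: "\<And>g. g \<in> C \<Longrightarrow> \<exists>g'\<in>C. \<forall>t. \<bar>t\<bar> < \<epsilon> \<longrightarrow> (g has_vector_derivative g' t) (at t)"
  shows "smooth_germ f"
proof -
  obtain D where D: "\<And>g. g \<in> C \<Longrightarrow> D g \<in> C"
      "\<And>g t. g \<in> C \<Longrightarrow> \<bar>t\<bar> < \<epsilon> \<Longrightarrow> (g has_vector_derivative D g t) (at t)"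
    using closed by metis
  have "(D ^^ n) f \<in> C" for n by (induction n) (auto simp: D assms(2))
  then show ?thesis
    by (intro smooth_germ_tower[of \<epsilon> "\<lambda>n. (D ^^ n) f"]) (auto simp: D assms(1))
qed

section \<open>Sums and products of smooth germs\<close>

lemma smooth_germ_add:
  assumes "smooth_germ f" "smooth_germ g"
  shows "smooth_germ (\<lambda>t. f t + g t)"
proof -
  obtain \<epsilon> \<delta> where "\<epsilon> > 0" "\<delta> > 0"
    and f: "\<And>n t. \<bar>t\<bar> < \<epsilon> \<Longrightarrow> (nth_vderiv n f has_vector_derivative nth_vderiv (Suc n) f t) (at t)"
    and g: "\<And>n t. \<bar>t\<bar> < \<delta> \<Longrightarrow> (nth_vderiv n g has_vector_derivative nth_vderiv (Suc n) g t) (at t)"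
    using assms unfolding smooth_germ_iff by blast
  show ?thesis
    by (rule smooth_germ_tower[of "min \<epsilon> \<delta>" "\<lambda>n t. nth_vderiv n f t + nth_vderiv n g t"])
       (use \<open>\<epsilon> > 0\<close> \<open>\<delta> > 0\<close> in \<open>auto intro!: has_vector_derivative_add f g\<close>)
qed

text \<open>For derivative sequences \<open>F\<close> and \<open>G\<close> this class is closed
  under differentiation, which replaces the general Leibniz formula and its binomial
  coefficients.\<close>

inductive_set product_sums ::
    "(nat \<Rightarrow> real \<Rightarrow> real) \<Rightarrow> (nat \<Rightarrow> real \<Rightarrow> 'a::real_normed_vector) \<Rightarrow> (real \<Rightarrow> 'a) set"
  for F G where
  product: "(\<lambda>t. F i t *\<^sub>R G j t) \<in> product_sums F G"
| add: "h \<in> product_sums F G \<Longrightarrow> k \<in> product_sums F G \<Longrightarrow> (\<lambda>t. h t + k t) \<in> product_sums F G"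

lemma smooth_germ_scaleR:
  assumes "smooth_germ f" "smooth_germ g"
  shows "smooth_germ (\<lambda>t. f t *\<^sub>R g t)"
proof -
  define F where "F = (\<lambda>n. nth_vderiv n f)"
  define G where "G = (\<lambda>n. nth_vderiv n g)"
  obtain \<epsilon> \<delta> where pos: "\<epsilon> > 0" "\<delta> > 0"
    and F: "\<And>n t. \<bar>t\<bar> < \<epsilon> \<Longrightarrow> (F n has_vector_derivative F (Suc n) t) (at t)"
    and G: "\<And>n t. \<bar>t\<bar> < \<delta> \<Longrightarrow> (G n has_vector_derivative G (Suc n) t) (at t)"
    using assms unfolding smooth_germ_iff F_def G_def by blast
  have "\<exists>h'\<in>product_sums F G. \<forall>t. \<bar>t\<bar> < min \<epsilon> \<delta> \<longrightarrow> (h has_vector_derivative h' t) (at t)"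
    if "h \<in> product_sums F G" for h
    using that
  proof induction
    case (product i j)
    have deriv: "((\<lambda>t. F i t *\<^sub>R G j t) has_vector_derivative
        F i t *\<^sub>R G (Suc j) t + F (Suc i) t *\<^sub>R G j t) (at t)" if "\<bar>t\<bar> < min \<epsilon> \<delta>" for t
      using bounded_bilinear.has_vector_derivative[OF bounded_bilinear_scaleR, OF F G] that by auto
    \<comment> \<open>The product rule turns one generator into a sum of two generators.\<close>
    have "(\<lambda>t. F i t *\<^sub>R G (Suc j) t + F (Suc i) t *\<^sub>R G j t) \<in> product_sums F G"
      by (rule product_sums.add[OF product_sums.product product_sums.product])
    then show ?case
    proof (rule bexI[rotated], intro allI impI)
      fix t :: real assume t: "\<bar>t\<bar> < min \<epsilon> \<delta>"
      show "((\<lambda>t. F i t *\<^sub>R G j t) has_vector_derivative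
        F i t *\<^sub>R G (Suc j) t + F (Suc i) t *\<^sub>R G j t) (at t)"
        using deriv t by blast
    qed
  next
    case (add h k)
    then obtain h' k' where "h' \<in> product_sums F G" "k' \<in> product_sums F G"
      and "\<And>t. \<bar>t\<bar> < min \<epsilon> \<delta> \<Longrightarrow> (h has_vector_derivative h' t) (at t)"
      and "\<And>t. \<bar>t\<bar> < min \<epsilon> \<delta> \<Longrightarrow> (k has_vector_derivative k' t) (at t)"
      by metis
    then show ?case
      by (intro bexI[OF _ product_sums.add[of h' _ _ k']]) (auto intro!: has_vector_derivative_add)
  qed
  moreover have "(\<lambda>t. f t *\<^sub>R g t) \<in> product_sums F G"
    using product_sums.product[of F 0 G 0] by (simp add: F_def G_def)
  ultimately show ?thesis
    using pos by (intro smooth_germ_coinduct[of "min \<epsilon> \<delta>" _ "product_sums F G"]) auto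
qed

lemma smooth_germ_isCont:
  assumes "smooth_germ f"
  shows "isCont f 0"
proof -
  have "(f has_vector_derivative nth_vderiv (Suc 0) f 0) (at 0)"
    using assms unfolding smooth_germ_iff by (metis abs_zero nth_vderiv_0)
  then show ?thesis by (rule has_vector_derivative_continuous)
qed

section \<open>Cancelling powers of the parameter\<close>

text \<open>Hadamard's lemma: the quotient of \<open>f\<close> by the parameter is
  \<open>\<integral>\<^sub>0\<^sup>1 f' (s t) ds\<close>, which can be differentiated under the integral sign.\<close>

lemma smooth_germ_divide:
  fixes f :: "real \<Rightarrow> 'a::banach"
  assumes "smooth_germ f" "f 0 = 0"
  obtains g where "smooth_germ g" "\<forall>\<^sub>F t in nhds 0. f t = t *\<^sub>R g t"
    "\<And>n. nth_vderiv n g 0 = nth_vderiv (Suc n) f 0 /\<^sub>R real (Suc n)"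
proof -
  define F where "F = (\<lambda>n. nth_vderiv n f)"
  obtain \<epsilon> where pos: "\<epsilon> > 0"
    and F: "\<And>n t. \<bar>t\<bar> < \<epsilon> \<Longrightarrow> (F n has_vector_derivative F (Suc n) t) (at t)"
    using assms unfolding smooth_germ_iff F_def by blast
  \<comment> \<open>\<open>G n\<close> is the formal \<open>n\<close>-th derivative of
    \<open>G 0\<close>: each differentiation in \<open>t\<close> under the integral sign raises the
    order of \<open>F\<close> and brings out a factor \<open>s\<close>.\<close>
  define G where "G = (\<lambda>n t. integral (cbox 0 1) (\<lambda>s. s ^ n *\<^sub>R F (Suc n) (t * s)))"
  define U where "U = {-\<epsilon><..<\<epsilon>}"
  have mult_bound: "\<bar>t * s\<bar> < \<epsilon>" if "\<bar>t\<bar> < \<epsilon>" "0 \<le> s" "s \<le> 1" for t s :: real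
  proof -
    have "\<bar>t * s\<bar> \<le> \<bar>t\<bar> * 1" unfolding abs_mult using that by (intro mult_left_mono) auto
    then show ?thesis using that by simp
  qed
  have mult_U: "t * s \<in> U" if "t \<in> U" "0 \<le> s" "s \<le> 1" for t s
    using mult_bound[of t s] that unfolding U_def by (simp add: abs_less_iff)
  have contF: "continuous_on U (F n)" for n
    by (intro continuous_at_imp_continuous_on ballI has_vector_derivative_continuous[OF F])
       (auto simp: U_def)
  have cont: "continuous_on (U \<times> cbox 0 1) (\<lambda>(t, s). s ^ k *\<^sub>R F n (t * s))" for n k
    unfolding split_beta
    by (intro continuous_intros continuous_on_compose2[OF contF[of n]])
       (auto intro: mult_U)
  have cont1: "continuous_on (cbox 0 1) (\<lambda>s. s ^ k *\<^sub>R F n (t * s))" if "t \<in> U" for n k t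
    by (intro continuous_intros continuous_on_compose2[OF contF[of n]])
       (use that in \<open>auto intro: mult_U\<close>)
  have chain: "((\<lambda>t. s ^ k *\<^sub>R F n (t * s)) has_vector_derivative s ^ Suc k *\<^sub>R F (Suc n) (t * s))
      (at t within V)" if "\<bar>t\<bar> < \<epsilon>" "0 \<le> s" "s \<le> 1" for s t n k V
  proof -
    have "((\<lambda>t. t * s) has_vector_derivative s) (at t within V)"
      by (auto intro!: derivative_eq_intros)
    then have "(F n \<circ> (\<lambda>t. t * s) has_vector_derivative s *\<^sub>R F (Suc n) (t * s)) (at t within V)"
      using F[OF mult_bound[OF that], of n]
      by (intro vector_diff_chain_within) (auto intro: has_vector_derivative_at_within)
    then have "((\<lambda>t. F n (t * s)) has_vector_derivative s *\<^sub>R F (Suc n) (t * s)) (at t within V)"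
      by (simp add: o_def)
    from has_vector_derivative_scaleR[OF DERIV_const[of "s ^ k"] this]
    show ?thesis by (simp add: mult.commute)
  qed
  have G: "(G n has_vector_derivative G (Suc n) t) (at t)" if "\<bar>t\<bar> < \<epsilon>" for n t
  proof -
    \<comment> \<open>The Leibniz rule yields a derivative within the convex set \<open>U\<close>;
      as \<open>U\<close> is open, this is the full derivative.\<close>
    have "(G n has_vector_derivative G (Suc n) t) (at t within U)"
      unfolding G_def
    proof (rule leibniz_rule_vector_derivative)
      show "((\<lambda>t. s ^ n *\<^sub>R F (Suc n) (t * s)) has_vector_derivative
          s ^ Suc n *\<^sub>R F (Suc (Suc n)) (t * s)) (at t within U)"
        if "t \<in> U" "s \<in> cbox 0 1" for t s
        using that chain by (auto simp: U_def)
      show "(\<lambda>s. s ^ n *\<^sub>R F (Suc n) (t * s)) integrable_on cbox 0 1" if "t \<in> U" for t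
        using that by (intro integrable_continuous cont1)
    qed (use that cont[of "Suc n" "Suc (Suc n)"] in \<open>auto simp: U_def simp del: power_Suc\<close>)
    moreover have "at t within U = at t"
      by (rule at_within_open) (use that in \<open>auto simp: U_def\<close>)
    ultimately show ?thesis by simp
  qed
  have eq: "f t = t *\<^sub>R G 0 t" if "\<bar>t\<bar> < \<epsilon>" for t
  proof -
    \<comment> \<open>The fundamental theorem is applied along the segment from 0 to
      \<open>t\<close>; the lower endpoint contributes \<open>f 0 = 0\<close>.\<close>
    have "((\<lambda>s. t *\<^sub>R F 1 (t * s)) has_integral F 0 (t * 1) - F 0 (t * 0)) {0..1}"
    proof (rule fundamental_theorem_of_calculus)
      fix s :: real assume s: "s \<in> {0..1}"
      have "((\<lambda>s. t * s) has_vector_derivative t) (at s within {0..1})"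
        by (auto intro!: derivative_eq_intros)
      then have "(F 0 \<circ> (\<lambda>s. t * s) has_vector_derivative t *\<^sub>R F 1 (t * s)) (at s within {0..1})"
        using F[OF mult_bound[OF that], of s 0] s
        by (intro vector_diff_chain_within) (auto intro: has_vector_derivative_at_within)
      then show "((\<lambda>s. F 0 (t * s)) has_vector_derivative t *\<^sub>R F 1 (t * s)) (at s within {0..1})"
        by (simp add: o_def)
    qed simp
    from integral_unique[OF this] show ?thesis
      using assms(2) by (simp add: F_def G_def)
  qed
  \<comment> \<open>At \<open>t = 0\<close> the integrand is \<open>s ^ n\<close> times a constant
    vector, and \<open>s ^ n\<close> integrates to \<open>1 / (n + 1)\<close>.\<close>
  have G0: "G n 0 = F (Suc n) 0 /\<^sub>R real (Suc n)" for n
  proof -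
    have "((\<lambda>s. s ^ n) has_integral (1 ^ Suc n / real (Suc n) - 0 ^ Suc n / real (Suc n))) {0..1::real}"
      by (rule fundamental_theorem_of_calculus)
         (auto intro!: derivative_eq_intros
           simp: has_real_derivative_iff_has_vector_derivative[symmetric] simp del: of_nat_Suc power_Suc)
    from has_integral_scaleR_left[OF this, of "F (Suc n) 0"]
    show ?thesis by (simp add: G_def integral_unique divide_inverse)
  qed
  show ?thesis
  proof
    show "smooth_germ (G 0)"
      by (rule smooth_germ_tower[of \<epsilon> G]) (use pos G in auto)
    show "\<forall>\<^sub>F t in nhds 0. f t = t *\<^sub>R G 0 t"
      unfolding eventually_nhds_metric using pos eq by (auto simp: dist_real_def)
    show "nth_vderiv n (G 0) 0 = nth_vderiv (Suc n) f 0 /\<^sub>R real (Suc n)" for n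
      using nth_vderiv_eq_tower[of \<epsilon> G "G 0" 0 n] pos G G0 by (simp add: F_def)
  qed
qed

text \<open>Divides by the parameter \<open>m\<close> times. The quotient's derivatives at 0 are
  those of the dividend, shifted by one and multiplied by nonzero factors, so each division lowers
  the order by exactly one.\<close>

lemma smooth_germ_cancel_power:
  fixes f :: "real \<Rightarrow> real"
  assumes "smooth_germ f" "zero_order f p" "m \<le> p"
  obtains g where "smooth_germ g" "zero_order g (p - m)" "\<forall>\<^sub>F t in nhds 0. f t = t ^ m * g t"
proof -
  have "\<exists>g. smooth_germ g \<and> zero_order g (p - m) \<and> (\<forall>\<^sub>F t in nhds 0. f t = t ^ m * g t)"
    using assms(3)
  proof (induction m)
    case 0
    then show ?case using assms by auto
  next
    case (Suc m)
    then obtain g where g: "smooth_germ g" "zero_order g (p - m)" "\<forall>\<^sub>F t in nhds 0. f t = t ^ m * g t"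
      by auto
    \<comment> \<open>The order still left is positive, so \<open>g\<close> vanishes at 0 and can be
      divided once more.\<close>
    have pm: "p - m = Suc (p - Suc m)" using Suc.prems by simp
    have "g 0 = 0" using g(2) unfolding pm zero_order_def by (metis nth_vderiv_0 zero_less_Suc)
    then obtain h where h: "smooth_germ h" "\<forall>\<^sub>F t in nhds 0. g t = t *\<^sub>R h t"
      "\<And>n. nth_vderiv n h 0 = nth_vderiv (Suc n) g 0 /\<^sub>R real (Suc n)"
      using smooth_germ_divide[OF g(1)] by blast
    have "zero_order h (p - Suc m)"
      using g(2) unfolding pm zero_order_def h(3) by auto
    moreover have "\<forall>\<^sub>F t in nhds 0. f t = t ^ Suc m * h t"
      using g(3) h(2) by eventually_elim simp
    ultimately show ?case using h(1) by blast
  qed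
  then show ?thesis using that by blast
qed

lemma zero_order_at_0: "zero_order f p \<Longrightarrow> f 0 \<noteq> 0 \<longleftrightarrow> p = 0"
  unfolding zero_order_def by (metis gr0I nth_vderiv_0)

text \<open>Dividing the error bound by \<open>t ^ p\<close> gives
  \<open>\<bar>g t - a\<bar> \<le> c * \<bar>t\<bar>\<close> for small \<open>t \<noteq> 0\<close>,
  and continuity of \<open>g\<close> carries the limit to 0. It identifies prescribed leading
  coefficients with values of the cancelled factors.\<close>

lemma leading_coeff_unique:
  fixes f g :: "real \<Rightarrow> real"
  assumes "isCont g 0" "\<forall>\<^sub>F t in nhds 0. f t = t ^ p * g t"
    and "(\<lambda>t. f t - a * t ^ p) \<in> O[at 0](\<lambda>t. t ^ (p + 1))"
  shows "g 0 = a"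
proof -
  have ev: "\<forall>\<^sub>F t in at 0. f t = t ^ p * g t \<and> t \<noteq> 0"
    using assms(2) by (auto simp: eventually_at_filter elim: eventually_mono)
  obtain c where "\<forall>\<^sub>F t in at 0. norm (f t - a * t ^ p) \<le> c * norm (t ^ (p + 1))"
    using assms(3) by (auto elim: landau_o.bigE)
  then have "\<forall>\<^sub>F t in at 0. norm (g t - a) \<le> c * \<bar>t\<bar>"
    using ev
  proof eventually_elim
    case (elim t)
    then have "f t - a * t ^ p = t ^ p * (g t - a)" by (simp add: algebra_simps)
    with elim have "\<bar>t\<bar> ^ p * \<bar>g t - a\<bar> \<le> \<bar>t\<bar> ^ p * (c * \<bar>t\<bar>)"
      by (simp add: abs_mult power_abs ac_simps)
    then show ?case using elim by simp
  qed
  moreover have "((\<lambda>t::real. c * \<bar>t\<bar>) \<longlongrightarrow> 0) (at 0)"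
    by (auto intro!: tendsto_eq_intros)
  ultimately have "((\<lambda>t. g t - a) \<longlongrightarrow> 0) (at 0)"
    by (rule Lim_null_comparison)
  then have "(g \<longlongrightarrow> a) (at 0)" by (simp add: LIM_zero_iff)
  then show ?thesis using assms(1) unfolding isCont_def by (rule LIM_unique[THEN sym])
qed

section \<open>Points of the projective plane\<close>

lemma hpt_scale:
  assumes "c \<noteq> 0" "(x, w) \<noteq> 0"
  shows "hpt (c *\<^sub>R x) (c * w) = hpt x w"
proof -
  have "(c *\<^sub>R x, c * w) \<noteq> 0" using assms by (auto simp: zero_prod_def)
  then show ?thesis using assms by (metis hpt_eq_iff)
qed

text \<open>By definition of the quotient topology, an open set of points pulls back to an open set
  of nonzero vectors, which the coordinates eventually enter.\<close>

lemma tendsto_hpt: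
  assumes "(X \<longlongrightarrow> x) \<F>" "(W \<longlongrightarrow> w) \<F>" "(x, w) \<noteq> 0"
  shows "((\<lambda>u. hpt (X u) (W u)) \<longlongrightarrow> hpt x w) \<F>"
proof (rule topological_tendstoI)
  fix U :: "rp2 set" assume U: "open U" "hpt x w \<in> U"
  have "((\<lambda>u. (X u, W u)) \<longlongrightarrow> (x, w)) \<F>" by (intro tendsto_intros assms)
  moreover have "open {v. v \<noteq> 0 \<and> abs_rp2 v \<in> U}" using U by (simp add: open_rp2_def)
  moreover have "(x, w) \<in> {v. v \<noteq> 0 \<and> abs_rp2 v \<in> U}" using U assms(3) by (simp add: hpt_def)
  ultimately have "\<forall>\<^sub>F u in \<F>. (X u, W u) \<in> {v. v \<noteq> 0 \<and> abs_rp2 v \<in> U}"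
    by (rule topological_tendstoD)
  then show "\<forall>\<^sub>F u in \<F>. hpt (X u) (W u) \<in> U"
    by eventually_elim (simp add: hpt_def)
qed

text \<open>For \<open>u \<noteq> 0\<close> the factor \<open>u ^ m\<close> is a nonzero rescaling,
  so both coordinate pairs give the same point. The limit avoids \<open>u = 0\<close>, where for
  \<open>m > 0\<close> the original coordinates vanish and \<open>hpt\<close> is
  unspecified.\<close>

lemma cancelled_coords_tendsto:
  assumes "cancelled_coords m x w X W"
  shows "((\<lambda>u. hpt (x u) (w u)) \<longlongrightarrow> hpt (X 0) (W 0)) (at 0)"
proof -
  have cont: "isCont X 0" "isCont W 0"
    and ev: "\<forall>\<^sub>F u in nhds 0. x u = u ^ m *\<^sub>R X u \<and> w u = u ^ m * W u \<and> (X u, W u) \<noteq> 0"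
    using assms by (auto simp: cancelled_coords_def smooth_germ_isCont)
  have "((\<lambda>u. hpt (X u) (W u)) \<longlongrightarrow> hpt (X 0) (W 0)) (at 0)"
    \<comment> \<open>The filter \<open>nhds 0\<close> includes 0 itself, so
      \<open>(X 0, W 0)\<close> is nonzero.\<close>
    using cont eventually_nhds_x_imp_x[OF ev] by (intro tendsto_hpt) (auto simp: isCont_def)
  moreover have "\<forall>\<^sub>F u in at 0. hpt (X u) (W u) = hpt (x u) (w u)"
    unfolding eventually_at_filter using ev
    by eventually_elim (metis hpt_scale power_not_zero)
  ultimately show ?thesis by (rule Lim_transform_eventually)
qed

section \<open>The centre symmetry set\<close>

lemma det2_eq: "det2 v w = v$1 * w$2 - v$2 * w$1"
  by (simp add: det2_def det_2)

text \<open>Boundedness is automatic in finite dimension; the purpose is the product rule for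
  \<open>det2\<close>.\<close>

lemma bounded_bilinear_det2: "bounded_bilinear det2"
  unfolding bilinear_conv_bounded_bilinear[symmetric] bilinear_def
  by (auto intro!: linearI simp: det2_eq algebra_simps)

lemma det2_self: "det2 v v = 0"
  by (simp add: det2_eq)

lemma det2_eq_0_imp_scaleR:
  assumes "det2 v w = 0" "w \<noteq> 0"
  obtains c where "v = c *\<^sub>R w"
proof -
  \<comment> \<open>The coefficient is that of the orthogonal projection of \<open>v\<close> onto
    \<open>w\<close>.\<close>
  have "v = ((v \<bullet> w) / (w \<bullet> w)) *\<^sub>R w"
  proof -
    have "w$1 * w$1 + w$2 * w$2 \<noteq> 0"
      using assms(2) by (auto simp: vec_eq_iff forall_2 sum_squares_eq_zero_iff)
    with assms(1) show ?thesis
      by (simp add: vec_eq_iff forall_2 inner_vec_def sum_2 det2_eq field_simps)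
  qed
  then show ?thesis by (rule that)
qed

text \<open>The parametrisation is the affine combination of \<open>\<gamma>p u\<close> and
  \<open>\<gamma>m u\<close> with weights \<open>\<rho>m u\<close> and \<open>\<rho>p u\<close>
  divided by their sum; the lemma clears this denominator.\<close>

lemma css_numerator_eq_scaleR_param:
  assumes "\<rho>p u + \<rho>m u \<noteq> 0"
  shows "css_numerator \<gamma>p \<gamma>m \<rho>p \<rho>m u = (\<rho>p u + \<rho>m u) *\<^sub>R affine_css_param \<gamma>p \<gamma>m \<rho>p \<rho>m u"
proof -
  have "(\<rho>p u + \<rho>m u) *\<^sub>R affine_css_param \<gamma>p \<gamma>m \<rho>p \<rho>m u
      = (\<rho>p u + \<rho>m u) *\<^sub>R \<gamma>m u + \<rho>m u *\<^sub>R (\<gamma>p u - \<gamma>m u)"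
    using assms by (simp add: affine_css_param_def scaleR_add_right)
  then show ?thesis by (simp add: css_numerator_def algebra_simps)
qed

lemma projective_css_eq_param:
  assumes "\<rho>p u + \<rho>m u \<noteq> 0"
  shows "projective_css \<gamma>p \<gamma>m \<rho>p \<rho>m u = hpt (affine_css_param \<gamma>p \<gamma>m \<rho>p \<rho>m u) 1"
  using hpt_scale[OF assms, of "affine_css_param \<gamma>p \<gamma>m \<rho>p \<rho>m u" 1] assms
  by (simp add: projective_css_def css_numerator_eq_scaleR_param zero_prod_def)

text \<open>Product rule: \<open>x - \<gamma>m s\<close> has derivative
  \<open>\<rho>m *\<^sub>R e\<close> and the chord has derivative
  \<open>(\<rho>p + \<rho>m) *\<^sub>R e\<close>. The minus sign comes from antisymmetry of
  \<open>det2\<close>. Here \<open>\<rho>p\<close> and \<open>\<rho>m\<close> are numbers, the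
  values at \<open>u\<close>.\<close>

lemma chord_derivative:
  assumes "(\<gamma>p has_vector_derivative \<rho>p *\<^sub>R e) (at u)"
    and "(\<gamma>m has_vector_derivative - (\<rho>m *\<^sub>R e)) (at u)"
  shows "((\<lambda>s. det2 (x - \<gamma>m s) (\<gamma>p s - \<gamma>m s)) has_real_derivative
      (\<rho>p + \<rho>m) * det2 (x - \<gamma>m u) e - \<rho>m * det2 (\<gamma>p u - \<gamma>m u) e) (at u)"
proof -
  have "((\<lambda>s. x - \<gamma>m s) has_vector_derivative \<rho>m *\<^sub>R e) (at u)"
    "((\<lambda>s. \<gamma>p s - \<gamma>m s) has_vector_derivative (\<rho>p + \<rho>m) *\<^sub>R e) (at u)"
    using assms by (auto intro!: derivative_eq_intros simp: algebra_simps)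
  from bounded_bilinear.has_vector_derivative[OF bounded_bilinear_det2 this]
  show ?thesis
    by (simp add: has_real_derivative_iff_has_vector_derivative det2_eq algebra_simps)
qed

text \<open>On the chord line, \<open>x - \<gamma>m u = c *\<^sub>R d\<close>, and the derivative
  condition reads \<open>(\<rho>p u + \<rho>m u) * c * det2 d e = \<rho>m u * det2 d e\<close>.
  Transversality cancels the determinant and the nonzero sum determines \<open>c\<close>.\<close>

lemma affine_css_at_eq:
  assumes "(\<gamma>p has_vector_derivative \<rho>p u *\<^sub>R e) (at u)"
    and "(\<gamma>m has_vector_derivative - (\<rho>m u *\<^sub>R e)) (at u)"
    and sum: "\<rho>p u + \<rho>m u \<noteq> 0" and transverse: "det2 (\<gamma>p u - \<gamma>m u) e \<noteq> 0"
  shows "affine_css_at \<gamma>p \<gamma>m u = {affine_css_param \<gamma>p \<gamma>m \<rho>p \<rho>m u}"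
proof -
  define d where "d = \<gamma>p u - \<gamma>m u"
  \<comment> \<open>Uniqueness of derivatives turns the envelope condition into an equation linear
    in \<open>x - \<gamma>m u\<close>.\<close>
  have deriv: "((\<lambda>s. det2 (x - \<gamma>m s) (\<gamma>p s - \<gamma>m s)) has_real_derivative 0) (at u) \<longleftrightarrow>
      (\<rho>p u + \<rho>m u) * det2 (x - \<gamma>m u) e = \<rho>m u * det2 d e" for x
    using chord_derivative[OF assms(1,2), of x] DERIV_unique unfolding d_def by force
  have "d \<noteq> 0" using transverse by (auto simp: d_def det2_eq)
  have "x \<in> affine_css_at \<gamma>p \<gamma>m u \<longleftrightarrow> x = affine_css_param \<gamma>p \<gamma>m \<rho>p \<rho>m u" for x
  proof
    assume "x \<in> affine_css_at \<gamma>p \<gamma>m u"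
    then have x: "det2 (x - \<gamma>m u) d = 0"
        "(\<rho>p u + \<rho>m u) * det2 (x - \<gamma>m u) e = \<rho>m u * det2 d e"
      unfolding affine_css_at_def envelope_at_def deriv by (auto simp: d_def)
    obtain c where c: "x - \<gamma>m u = c *\<^sub>R d" using det2_eq_0_imp_scaleR[OF x(1) \<open>d \<noteq> 0\<close>] .
    have "((\<rho>p u + \<rho>m u) * c) * det2 d e = \<rho>m u * det2 d e"
      using x(2) unfolding c by (simp add: det2_eq algebra_simps)
    then have "(\<rho>p u + \<rho>m u) * c = \<rho>m u"
      using transverse by (simp add: d_def)
    then have "c = \<rho>m u / (\<rho>p u + \<rho>m u)"
      using sum by (simp add: eq_divide_eq mult.commute)
    then show "x = affine_css_param \<gamma>p \<gamma>m \<rho>p \<rho>m u"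
      using c by (simp add: affine_css_param_def d_def algebra_simps)
  next
    assume "x = affine_css_param \<gamma>p \<gamma>m \<rho>p \<rho>m u"
    then have c: "x - \<gamma>m u = (\<rho>m u / (\<rho>p u + \<rho>m u)) *\<^sub>R d"
      by (simp add: affine_css_param_def d_def)
    have det: "det2 (k *\<^sub>R v) w = k * det2 v w" for k v w by (simp add: det2_eq algebra_simps)
    show "x \<in> affine_css_at \<gamma>p \<gamma>m u"
      unfolding affine_css_at_def envelope_at_def mem_Collect_eq deriv
      unfolding d_def[symmetric] c det using sum by (simp add: det2_self)
  qed
  then show ?thesis by blast
qed

section \<open>Cancelled homogeneous coordinates and their values at 0\<close>

text \<open>Both coordinates are linear in the pair of radii, so a common factor comes out of
  them.\<close>

lemma css_cancel_power:
  assumes smooth: "smooth_germ \<gamma>p" "smooth_germ \<gamma>m" "smooth_germ A" "smooth_germ B"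
    and A: "\<forall>\<^sub>F u in nhds 0. \<rho>p u = u ^ m * A u" and B: "\<forall>\<^sub>F u in nhds 0. \<rho>m u = u ^ m * B u"
    and nz: "A 0 \<noteq> 0 \<or> B 0 \<noteq> 0" and chord: "\<gamma>p 0 \<noteq> \<gamma>m 0"
  shows "cancelled_coords m (css_numerator \<gamma>p \<gamma>m \<rho>p \<rho>m) (\<lambda>u. \<rho>p u + \<rho>m u)
    (css_numerator \<gamma>p \<gamma>m A B) (\<lambda>u. A u + B u)"
proof -
  let ?X = "css_numerator \<gamma>p \<gamma>m A B" and ?W = "\<lambda>u. A u + B u"
  have X: "smooth_germ ?X"
    unfolding css_numerator_def by (intro smooth_germ_add smooth_germ_scaleR smooth)
  have W: "smooth_germ ?W" by (intro smooth_germ_add smooth)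
  have "(?X 0, ?W 0) \<noteq> 0"
  proof
    assume "(?X 0, ?W 0) = 0"
    then have "B 0 *\<^sub>R \<gamma>p 0 + A 0 *\<^sub>R \<gamma>m 0 = 0" and "A 0 = - B 0"
      by (auto simp: zero_prod_def css_numerator_def)
    \<comment> \<open>A vanishing second coordinate makes the first a multiple of the nonzero chord,
      which forces \<open>B 0 = 0\<close> and then \<open>A 0 = 0\<close>.\<close>
    then have "B 0 *\<^sub>R (\<gamma>p 0 - \<gamma>m 0) = 0" by (simp add: algebra_simps)
    then show False using nz chord \<open>A 0 = - B 0\<close> by auto
  qed
  moreover have "((\<lambda>u. (?X u, ?W u)) \<longlongrightarrow> (?X 0, ?W 0)) (nhds 0)"
    using continuous_Pair[OF smooth_germ_isCont[OF X] smooth_germ_isCont[OF W]]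
      tendsto_at_iff_tendsto_nhds[of "\<lambda>u. (?X u, ?W u)" 0] by (simp only: isCont_def)
  ultimately have "\<forall>\<^sub>F u in nhds 0. (?X u, ?W u) \<noteq> 0"
    by (intro tendsto_imp_eventually_ne)
  with A B have "\<forall>\<^sub>F u in nhds 0. css_numerator \<gamma>p \<gamma>m \<rho>p \<rho>m u = u ^ m *\<^sub>R ?X u \<and>
      \<rho>p u + \<rho>m u = u ^ m * ?W u \<and> (?X u, ?W u) \<noteq> 0"
  proof eventually_elim
    case (elim u)
    have "css_numerator \<gamma>p \<gamma>m \<rho>p \<rho>m u = u ^ m *\<^sub>R ?X u"
      unfolding css_numerator_def elim(1,2) by (simp add: scaleR_add_right)
    moreover have "\<rho>p u + \<rho>m u = u ^ m * ?W u"
      unfolding elim(1,2) by (rule distrib_left[symmetric])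
    ultimately show ?case using elim(3) by blast
  qed
  then show ?thesis using X W unfolding cancelled_coords_def by blast
qed

text \<open>Opposite radii make the numerator \<open>\<rho>m u\<close> times the chord, and this
  factor scales away. It serves both the original radii and the cancelled ones at 0.\<close>

lemma projective_css_at_zero_sum:
  assumes "\<rho>p u + \<rho>m u = 0" "\<rho>m u \<noteq> 0" "\<gamma>p u \<noteq> \<gamma>m u"
  shows "projective_css \<gamma>p \<gamma>m \<rho>p \<rho>m u = hpt (\<gamma>p u - \<gamma>m u) 0"
proof -
  have "\<rho>p u = - \<rho>m u" using assms(1) by simp
  then have "css_numerator \<gamma>p \<gamma>m \<rho>p \<rho>m u = \<rho>m u *\<^sub>R (\<gamma>p u - \<gamma>m u)"
    by (simp add: css_numerator_def algebra_simps)
  then show ?thesis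
    using hpt_scale[OF assms(2), of "\<gamma>p u - \<gamma>m u" 0] assms by (simp add: projective_css_def zero_prod_def)
qed

text \<open>If both radii vanish at 0, then \<open>S 0\<close> has zero coordinates and is
  unspecified; the clauses on zeros therefore concern the limit of \<open>S\<close> and the
  cancelled coordinates at 0.\<close>

theorem proposition5p1:
  fixes \<gamma>p \<gamma>m np nm :: "real \<Rightarrow> real^2" and \<rho>p \<rho>m :: "real \<Rightarrow> real" and \<theta>0 :: real
    and e \<Delta> :: "real \<Rightarrow> real^2" and \<Sigma>\<rho> :: "real \<Rightarrow> real" and S :: "real \<Rightarrow> rp2"
  assumes "angularly_regular_parallel_pair \<gamma>p np \<gamma>m nm"
    and "common_angular_parameter \<theta>0 \<gamma>p np \<gamma>m nm \<rho>p \<rho>m"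
  defines "e \<equiv> \<lambda>u. unit_vec (u + \<theta>0)"
    and "\<Delta> \<equiv> \<lambda>u. \<gamma>p u - \<gamma>m u"
    and "\<Sigma>\<rho> \<equiv> \<lambda>u. \<rho>p u + \<rho>m u"
    and "S \<equiv> projective_css \<gamma>p \<gamma>m \<rho>p \<rho>m"
  shows "(\<forall>\<^sub>F u in nhds 0. \<Sigma>\<rho> u \<noteq> 0 \<longrightarrow>
            S u = hpt (affine_css_param \<gamma>p \<gamma>m \<rho>p \<rho>m u) 1 \<and>
            (det2 (\<Delta> u) (e u) \<noteq> 0 \<longrightarrow> (\<lambda>x. hpt x 1) ` affine_css_at \<gamma>p \<gamma>m u = {S u}))
    \<and> (\<Delta> 0 \<noteq> 0 \<longrightarrow>
        (\<Sigma>\<rho> 0 = 0 \<and> \<rho>p 0 * \<rho>m 0 \<noteq> 0 \<longrightarrow> S 0 = hpt (\<Delta> 0) 0)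
      \<and> (\<forall>p q. 0 < p \<and> 0 < q \<and> zero_order \<rho>p p \<and> zero_order \<rho>m q \<longrightarrow>
          (\<exists>X W. cancelled_coords (min p q) (css_numerator \<gamma>p \<gamma>m \<rho>p \<rho>m) \<Sigma>\<rho> X W
             \<and> (S \<longlongrightarrow> hpt (X 0) (W 0)) (at 0)
             \<and> (p < q \<longrightarrow> hpt (X 0) (W 0) = hpt (\<gamma>m 0) 1)
             \<and> (q < p \<longrightarrow> hpt (X 0) (W 0) = hpt (\<gamma>p 0) 1)
             \<and> (\<forall>ap am. p = q
                  \<and> (\<lambda>u. \<rho>p u - ap * u ^ p) \<in> O[at 0](\<lambda>u. u ^ (p + 1))
                  \<and> (\<lambda>u. \<rho>m u - am * u ^ p) \<in> O[at 0](\<lambda>u. u ^ (p + 1))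
                  \<and> ap * am \<noteq> 0 \<longrightarrow>
                    (ap + am \<noteq> 0 \<longrightarrow>
                       hpt (X 0) (W 0) = hpt ((am *\<^sub>R \<gamma>p 0 + ap *\<^sub>R \<gamma>m 0) /\<^sub>R (ap + am)) 1)
                  \<and> (ap + am = 0 \<longrightarrow> hpt (X 0) (W 0) = hpt (\<Delta> 0) 0)))))"
proof -
  have smooth: "smooth_germ \<gamma>p" "smooth_germ \<gamma>m" "smooth_germ \<rho>p" "smooth_germ \<rho>m"
    using assms(1,2)
    by (auto simp: angularly_regular_parallel_pair_def cooriented_frontal_def
        common_angular_parameter_def)
  have "\<forall>\<^sub>F u in nhds 0. (\<gamma>p has_vector_derivative \<rho>p u *\<^sub>R e u) (at u) \<and>
      (\<gamma>m has_vector_derivative - (\<rho>m u *\<^sub>R e u)) (at u)"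
    using assms(2) by (auto simp: common_angular_parameter_def e_def elim: eventually_mono)
  then have affine: "\<forall>\<^sub>F u in nhds 0. \<Sigma>\<rho> u \<noteq> 0 \<longrightarrow>
      S u = hpt (affine_css_param \<gamma>p \<gamma>m \<rho>p \<rho>m u) 1 \<and>
      (det2 (\<Delta> u) (e u) \<noteq> 0 \<longrightarrow> (\<lambda>x. hpt x 1) ` affine_css_at \<gamma>p \<gamma>m u = {S u})"
    by eventually_elim
       (auto simp: \<Sigma>\<rho>_def S_def \<Delta>_def projective_css_eq_param affine_css_at_eq)
  have at_infinity: "S 0 = hpt (\<Delta> 0) 0"
    if "\<Delta> 0 \<noteq> 0" "\<Sigma>\<rho> 0 = 0" "\<rho>p 0 * \<rho>m 0 \<noteq> 0"
    using that projective_css_at_zero_sum[of \<rho>p 0 \<rho>m \<gamma>p \<gamma>m] by (auto simp: S_def \<Sigma>\<rho>_def \<Delta>_def)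
  have zeros: "\<exists>X W. cancelled_coords (min p q) (css_numerator \<gamma>p \<gamma>m \<rho>p \<rho>m) \<Sigma>\<rho> X W
             \<and> (S \<longlongrightarrow> hpt (X 0) (W 0)) (at 0)
             \<and> (p < q \<longrightarrow> hpt (X 0) (W 0) = hpt (\<gamma>m 0) 1)
             \<and> (q < p \<longrightarrow> hpt (X 0) (W 0) = hpt (\<gamma>p 0) 1)
             \<and> (\<forall>ap am. p = q
                  \<and> (\<lambda>u. \<rho>p u - ap * u ^ p) \<in> O[at 0](\<lambda>u. u ^ (p + 1))
                  \<and> (\<lambda>u. \<rho>m u - am * u ^ p) \<in> O[at 0](\<lambda>u. u ^ (p + 1))
                  \<and> ap * am \<noteq> 0 \<longrightarrow>
                    (ap + am \<noteq> 0 \<longrightarrow>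
                       hpt (X 0) (W 0) = hpt ((am *\<^sub>R \<gamma>p 0 + ap *\<^sub>R \<gamma>m 0) /\<^sub>R (ap + am)) 1)
                  \<and> (ap + am = 0 \<longrightarrow> hpt (X 0) (W 0) = hpt (\<Delta> 0) 0))"
    if chord: "\<Delta> 0 \<noteq> 0" and order: "zero_order \<rho>p p" "zero_order \<rho>m q" for p q
  proof -
    obtain A where A: "smooth_germ A" "zero_order A (p - min p q)"
        "\<forall>\<^sub>F u in nhds 0. \<rho>p u = u ^ min p q * A u"
      using smooth_germ_cancel_power[OF smooth(3) order(1), of "min p q"] by auto
    obtain B where B: "smooth_germ B" "zero_order B (q - min p q)"
        "\<forall>\<^sub>F u in nhds 0. \<rho>m u = u ^ min p q * B u"
      using smooth_germ_cancel_power[OF smooth(4) order(2), of "min p q"] by auto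
    \<comment> \<open>Truncated subtraction makes \<open>p - min p q\<close> zero exactly when
      \<open>p \<le> q\<close>, and symmetrically for \<open>q\<close>; hence \<open>A\<close> and
      \<open>B\<close> never both vanish at 0.\<close>
    have A0: "A 0 \<noteq> 0 \<longleftrightarrow> p \<le> q" and B0: "B 0 \<noteq> 0 \<longleftrightarrow> q \<le> p"
      using zero_order_at_0[OF A(2)] zero_order_at_0[OF B(2)] by auto
    define X where "X = css_numerator \<gamma>p \<gamma>m A B"
    define W where "W = (\<lambda>u. A u + B u)"
    \<comment> \<open>The limit is the centre symmetry map with \<open>A\<close> and
      \<open>B\<close> as radii, so the lemmas for arbitrary radii evaluate it.\<close>
    have XW: "hpt (X 0) (W 0) = projective_css \<gamma>p \<gamma>m A B 0"
      by (simp add: X_def W_def projective_css_def)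
    have coords: "cancelled_coords (min p q) (css_numerator \<gamma>p \<gamma>m \<rho>p \<rho>m) \<Sigma>\<rho> X W"
      unfolding X_def W_def \<Sigma>\<rho>_def
      using A B A0 B0 chord by (intro css_cancel_power smooth) (auto simp: \<Delta>_def)
    moreover have "(S \<longlongrightarrow> hpt (X 0) (W 0)) (at 0)"
      using cancelled_coords_tendsto[OF coords]
      by (simp add: S_def \<Sigma>\<rho>_def projective_css_def[abs_def])
    \<comment> \<open>Here \<open>B 0 = 0\<close> and \<open>A 0 \<noteq> 0\<close>, so the chord
      parameter \<open>B 0 / (A 0 + B 0)\<close> is 0; in the opposite case it is 1.\<close>
    moreover have "hpt (X 0) (W 0) = hpt (\<gamma>m 0) 1" if "p < q"
      using that A0 B0 by (simp add: XW projective_css_eq_param affine_css_param_def)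
    moreover have "hpt (X 0) (W 0) = hpt (\<gamma>p 0) 1" if "q < p"
      using that A0 B0 by (simp add: XW projective_css_eq_param affine_css_param_def)
    moreover have "(ap + am \<noteq> 0 \<longrightarrow>
          hpt (X 0) (W 0) = hpt ((am *\<^sub>R \<gamma>p 0 + ap *\<^sub>R \<gamma>m 0) /\<^sub>R (ap + am)) 1)
        \<and> (ap + am = 0 \<longrightarrow> hpt (X 0) (W 0) = hpt (\<Delta> 0) 0)"
      if "p = q" and ap: "(\<lambda>u. \<rho>p u - ap * u ^ p) \<in> O[at 0](\<lambda>u. u ^ (p + 1))"
        and am: "(\<lambda>u. \<rho>m u - am * u ^ p) \<in> O[at 0](\<lambda>u. u ^ (p + 1))"
        and nz: "ap * am \<noteq> 0" for ap am
    proof -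
      have coeffs: "A 0 = ap" "B 0 = am"
        using leading_coeff_unique[OF smooth_germ_isCont[OF A(1)] _ ap]
          leading_coeff_unique[OF smooth_germ_isCont[OF B(1)] _ am] A(3) B(3) \<open>p = q\<close> by auto
      have "affine_css_param \<gamma>p \<gamma>m A B 0 = (am *\<^sub>R \<gamma>p 0 + ap *\<^sub>R \<gamma>m 0) /\<^sub>R (ap + am)"
        if "ap + am \<noteq> 0"
        using css_numerator_eq_scaleR_param[of A 0 B \<gamma>p \<gamma>m] that
        by (simp add: coeffs css_numerator_def)
      then show ?thesis
        using projective_css_eq_param[of A 0 B \<gamma>p \<gamma>m]
          projective_css_at_zero_sum[of A 0 B \<gamma>p \<gamma>m] nz chord
        by (auto simp: XW coeffs \<Delta>_def)
    qed
    ultimately show ?thesis by blast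
  qed
  show ?thesis using affine at_infinity zeros by blast
qed

end
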